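(* Let $F$ satisfy the standing assumption, let $C\subseteq X$ be nonempty, and let $T\colon C\to X$ be $F$-firmly nonexpansive. Set $A=FT^{-1}-F$, let $\Phi$ be the Fitzpatrick function of $A$, and let $$\Psi(x,x^* )=\min_{(y+z,\,y^*+z^* )=2(x,x^* )}\Big(\tfrac12\Phi(y,y^* )+\tfrac12\Phi^*(z^*,z)+\tfrac18\big(\|y-z\|^2+\|y^*-z^*\|^2\big)\Big)$$ for $(x,x^* )\in X\times X^*$. Define $\widetilde A\colon X\rightrightarrows X^*$ by $\operatorname{gra}\widetilde A=\{(x,x^* )\in X\times X^*:\Psi(x,x^* )=\langle x,x^*\rangle\}$, and set $\widetilde T=(\widetilde A+F)^{-1}F$. Then $\widetilde T$ is a single-valued map $X\to X$ which is $F$-firmly nonexpansive and extends $T$ (i.e. $\widetilde T|_C=T$).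
   Context: $X$ is a real reflexive Banach space with dual $X^*$, pairing $\langle\cdot,\cdot\rangle$, norm $\|\cdot\|$ on $X$ and dual norm on $X^*$. Standing assumption: $F\colon X\to X^*$ is single-valued with full domain, maximal monotone, strictly monotone ($\langle x-y,Fx-Fy\rangle>0$ for $x\ne y$), 3*-monotone (for every $(x,x^* )\in X\times X^*$, $\sup_{y\in X}\langle x-y,Fy-x^*\rangle<+\infty$), and surjective. $T^{-1}$ is the graph inverse. The Fitzpatrick function of $A$ is $\Phi(x,x^* )=\sup_{(y,y^* )\in\operatorname{gra}A}(\langle x,y^*\rangle+\langle y,x^*\rangle-\langle y,y^*\rangle)$; $\Phi^*\colon X^*\times X\to\left]-\infty,+\infty\right]$ is its Fenchel conjugate, $\Phi^*(z^*,z)=\sup_{(x,x^* )}(\langle x,z^*\rangle+\langle z,x^*\rangle-\Phi(x,x^* ))$. $T\colon C\to X$ is $F$-firmly nonexpansive if $\langle Tx-Ty,FTx-FTy\rangle\le\langle Tx-Ty,Fx-Fy\rangle$ for all $x,y\in C$. *)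

theory Defs
  imports "HOL-Analysis.Analysis" "HOL-Library.Extended_Real"
begin

text \<open>A real Banach space X (type 'a) together with its dual X* (type 'b), linked by a
  pairing p x x' = <x, x'>.  The pairing identifies 'b isometrically with the space of
  bounded linear functionals on 'a (dual norm), and every bounded linear functional on 'b
  is of the form p x (reflexivity).\<close>

definition dual_pairing :: "('a::real_normed_vector \<Rightarrow> 'b::real_normed_vector \<Rightarrow> real) \<Rightarrow> bool" where
  "dual_pairing p \<longleftrightarrow>
     bounded_bilinear p \<and>
     (\<forall>x'. norm x' = (SUP x\<in>{x. norm x \<le> 1}. p x x')) \<and>
     (\<forall>f. bounded_linear f \<longrightarrow> (\<exists>x'. f = (\<lambda>x. p x x')))"

definition reflexive_pairing :: "('a::real_normed_vector \<Rightarrow> 'b::real_normed_vector \<Rightarrow> real) \<Rightarrow> bool" where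
  "reflexive_pairing p \<longleftrightarrow> dual_pairing p \<and>
     (\<forall>g. bounded_linear g \<longrightarrow> (\<exists>x. g = p x))"

definition monotone_op :: "('a::real_normed_vector \<Rightarrow> 'b \<Rightarrow> real) \<Rightarrow> ('a \<Rightarrow> 'b::real_normed_vector) \<Rightarrow> bool" where
  "monotone_op p F \<longleftrightarrow> (\<forall>x y. p (x - y) (F x - F y) \<ge> 0)"

definition maximal_monotone_op :: "('a::real_normed_vector \<Rightarrow> 'b \<Rightarrow> real) \<Rightarrow> ('a \<Rightarrow> 'b::real_normed_vector) \<Rightarrow> bool" where
  "maximal_monotone_op p F \<longleftrightarrow> monotone_op p F \<and>
     (\<forall>x x'. (\<forall>y. p (x - y) (x' - F y) \<ge> 0) \<longrightarrow> x' = F x)"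

definition strictly_monotone_op :: "('a::real_normed_vector \<Rightarrow> 'b \<Rightarrow> real) \<Rightarrow> ('a \<Rightarrow> 'b::real_normed_vector) \<Rightarrow> bool" where
  "strictly_monotone_op p F \<longleftrightarrow> (\<forall>x y. x \<noteq> y \<longrightarrow> p (x - y) (F x - F y) > 0)"

definition three_star_monotone_op :: "('a::real_normed_vector \<Rightarrow> 'b \<Rightarrow> real) \<Rightarrow> ('a \<Rightarrow> 'b::real_normed_vector) \<Rightarrow> bool" where
  "three_star_monotone_op p F \<longleftrightarrow> (\<forall>x x'. bdd_above ((\<lambda>y. p (x - y) (F y - x')) ` UNIV))"

definition F_firmly_nonexpansive ::
  "('a::real_normed_vector \<Rightarrow> 'b \<Rightarrow> real) \<Rightarrow> ('a \<Rightarrow> 'b::real_normed_vector) \<Rightarrow> 'a set \<Rightarrow> ('a \<Rightarrow> 'a) \<Rightarrow> bool" where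
  "F_firmly_nonexpansive p F C T \<longleftrightarrow>
     (\<forall>x\<in>C. \<forall>y\<in>C. p (T x - T y) (F (T x) - F (T y)) \<le> p (T x - T y) (F x - F y))"

definition fitzpatrick :: "('a \<Rightarrow> 'b \<Rightarrow> real) \<Rightarrow> ('a \<times> 'b) set \<Rightarrow> 'a \<times> 'b \<Rightarrow> ereal" where
  "fitzpatrick p G = (\<lambda>(x, x'). SUP (y, y')\<in>G. ereal (p x y' + p y x' - p y y'))"

definition fenchel_conj :: "('a \<Rightarrow> 'b \<Rightarrow> real) \<Rightarrow> ('a \<times> 'b \<Rightarrow> ereal) \<Rightarrow> 'b \<times> 'a \<Rightarrow> ereal" where
  "fenchel_conj p f = (\<lambda>(z', z). SUP (x, x')\<in>UNIV. ereal (p x z' + p z x') - f (x, x'))"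

text \<open>Graph of A = F T^{-1} - F, for T : C \<rightarrow> X.\<close>

definition graph_A :: "('a \<Rightarrow> 'b::ab_group_add) \<Rightarrow> 'a set \<Rightarrow> ('a \<Rightarrow> 'a) \<Rightarrow> ('a \<times> 'b) set" where
  "graph_A F C T = {(T x, F x - F (T x)) | x. x \<in> C}"

text \<open>The function \<Psi> (the minimum in the paper is written as an infimum).\<close>

definition Psi :: "('a::real_normed_vector \<Rightarrow> 'b::real_normed_vector \<Rightarrow> real) \<Rightarrow> ('a \<times> 'b \<Rightarrow> ereal) \<Rightarrow> 'a \<times> 'b \<Rightarrow> ereal" where
  "Psi p \<Phi> = (\<lambda>(x, x'). INF (y, y', z, z')\<in>{(y, y', z, z'). y + z = 2 *\<^sub>R x \<and> y' + z' = 2 *\<^sub>R x'}.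
      ereal (1/2) * \<Phi> (y, y') + ereal (1/2) * fenchel_conj p \<Phi> (z', z)
      + ereal ((norm (y - z))\<^sup>2 / 8 + (norm (y' - z'))\<^sup>2 / 8))"

definition graph_A_tilde :: "('a::real_normed_vector \<Rightarrow> 'b::real_normed_vector \<Rightarrow> real) \<Rightarrow> ('a \<Rightarrow> 'b) \<Rightarrow> 'a set \<Rightarrow> ('a \<Rightarrow> 'a) \<Rightarrow> ('a \<times> 'b) set" where
  "graph_A_tilde p F C T =
     {(x, x'). Psi p (fitzpatrick p (graph_A F C T)) (x, x') = ereal (p x x')}"

text \<open>\<tilde>T = (\<tilde>A + F)^{-1} F as a set-valued map: \<tilde>T x = {u. F x \<in> (\<tilde>A + F) u}.\<close>

definition T_tilde :: "('a::real_normed_vector \<Rightarrow> 'b::real_normed_vector \<Rightarrow> real) \<Rightarrow> ('a \<Rightarrow> 'b) \<Rightarrow> 'a set \<Rightarrow> ('a \<Rightarrow> 'a) \<Rightarrow> 'a \<Rightarrow> 'a set" where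
  "T_tilde p F C T x = {u. \<exists>a. (u, a) \<in> graph_A_tilde p F C T \<and> F x = a + F u}"

end

theory Submission
  imports Defs
begin

text \<open>On \<open>E = X \<times> X*\<close> put \<open>B(e, f) = \<langle>e1, f2\<rangle> + \<langle>f1, e2\<rangle>\<close> and \<open>q(e) = B(e, e) / 2 = \<langle>e1, e2\<rangle>\<close>; then \<open>E\<close> is
  isometrically its own dual through \<open>B\<close>. The function \<open>\<Psi>\<close> is convex and lies above \<open>q\<close>, which makes
  the contact set \<open>{\<Psi> = q}\<close>, the graph of \<open>A~\<close>, monotone. Together with strict
  monotonicity of \<open>F\<close> this yields everything except that \<open>T~ x\<close> is nonempty.

  For nonemptiness fix \<open>x\<close>, let \<open>N = {(t, Fx - Ft)}\<close> and \<open>k(e) = sup {q(n) - B(e, n) | n \<in> N}\<close>. By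
  3*-monotonicity \<open>k\<close> is finite everywhere, hence locally bounded above somewhere by Baire's theorem, and
  \<open>k \<ge> -q\<close> by maximality of \<open>F\<close>. A single Fenchel duality on \<open>E \<times> E\<close>, between \<open>\<Phi>(y)/2 + \<Phi>*(z)/2\<close>
  and \<open>|y - z|^2/8 + k((y + z)/2)\<close>, produces dual variables \<open>a, b\<close> whose midpoint \<open>u\<close> satisfies
  \<open>\<Psi>(u) \<le> q(u) - q(u - n)\<close> for all \<open>n \<in> N\<close>. As \<open>\<Psi> \<ge> q\<close>, this puts \<open>u\<close> on the graph of \<open>A~\<close>, and
  maximality of \<open>F\<close> gives \<open>Fx = u2 + F u1\<close>, that is, \<open>u1 \<in> T~ x\<close>.\<close>

subsection \<open>Hahn-Banach and Fenchel duality\<close>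

lemma convex_on_UNIV_D:
  "convex_on UNIV f \<Longrightarrow> 0 \<le> u \<Longrightarrow> 0 \<le> v \<Longrightarrow> u + v = 1 \<Longrightarrow>
    f (u *\<^sub>R x + v *\<^sub>R y) \<le> u * f x + v * f y"
  by (simp add: convex_on_def)

section \<open>Sublinear functionals and their linear minorants\<close>

definition sublinear :: "('a::real_vector \<Rightarrow> real) \<Rightarrow> bool" where
  "sublinear P \<longleftrightarrow> (\<forall>x y. P (x + y) \<le> P x + P y) \<and> (\<forall>c>0. \<forall>x. P (c *\<^sub>R x) = c * P x)"

lemma sublinear_add: "sublinear P \<Longrightarrow> P (x + y) \<le> P x + P y"
  by (simp add: sublinear_def)

lemma sublinear_scale: "sublinear P \<Longrightarrow> c > 0 \<Longrightarrow> P (c *\<^sub>R x) = c * P x"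
  by (simp add: sublinear_def)

lemma sublinear_0: "sublinear P \<Longrightarrow> P 0 = 0"
  using sublinear_scale[of P 2 0] by simp

lemma sublinear_minus: "sublinear P \<Longrightarrow> - P (- x) \<le> P x"
  using sublinear_add[of P x "- x"] sublinear_0[of P] by simp

text \<open>Supplies the chain bounds for Zorn. \<open>- P (- x)\<close> bounds all members from
  below, so the infimum is real; it stays subadditive because, of two members, one lies below
  both.\<close>

lemma sublinear_INF_chain:
  fixes P :: "'a::real_vector \<Rightarrow> real"
  assumes ne: "K \<noteq> {}" and K: "\<And>q. q \<in> K \<Longrightarrow> sublinear q \<and> (\<forall>x. q x \<le> P x)"
    and chain: "\<And>q r. q \<in> K \<Longrightarrow> r \<in> K \<Longrightarrow> (\<forall>x. q x \<le> r x) \<or> (\<forall>x. r x \<le> q x)"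
  shows "sublinear (\<lambda>x. INF q\<in>K. q x)" "q \<in> K \<Longrightarrow> (INF q\<in>K. q x) \<le> q x"
proof -
  have bdd: "bdd_below ((\<lambda>q. q x) ` K)" for x
  proof (rule bdd_belowI2)
    fix q assume "q \<in> K"
    then show "- P (- x) \<le> q x" using K[of q] sublinear_minus[of q x] by (smt (verit))
  qed
  show low: "(INF q\<in>K. q x) \<le> q x" if "q \<in> K" for q x
    by (rule cINF_lower[OF bdd that])
  show "sublinear (\<lambda>x. INF q\<in>K. q x)"
    unfolding sublinear_def
  proof (intro conjI allI impI)
    fix x y
    have sum: "(INF q\<in>K. q (x + y)) \<le> q x + r y" if qr: "q \<in> K" "r \<in> K" for q r
    proof -
      obtain s where s: "s \<in> K" "s x \<le> q x" "s y \<le> r y"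
        using chain[OF qr] qr by blast
      have "(INF q\<in>K. q (x + y)) \<le> s (x + y)" by (rule low[OF s(1)])
      also have "\<dots> \<le> s x + s y" using K[OF s(1)] sublinear_add by blast
      finally show ?thesis using s by linarith
    qed
    \<comment> \<open>The infimum over \<open>q\<close> is taken with \<open>r\<close> fixed, then
      the one over \<open>r\<close>.\<close>
    have "(INF q\<in>K. q (x + y)) - r y \<le> (INF q\<in>K. q x)" if "r \<in> K" for r
      by (rule cINF_greatest[OF ne]) (use sum[OF _ that] in \<open>simp add: algebra_simps\<close>)
    then have "(INF q\<in>K. q (x + y)) - (INF q\<in>K. q x) \<le> (INF q\<in>K. q y)"
      by (intro cINF_greatest[OF ne]) (simp add: algebra_simps)
    then show "(INF q\<in>K. q (x + y)) \<le> (INF q\<in>K. q x) + (INF q\<in>K. q y)" by simp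
  next
    fix c :: real and x assume c: "c > 0"
    \<comment> \<open>One inequality suffices: at \<open>inverse c\<close> and
      \<open>c *\<^sub>R x\<close> it becomes the converse.\<close>
    have 1: "c * (INF q\<in>K. q x) \<le> (INF q\<in>K. q (c *\<^sub>R x))" if "c > 0" for c x
    proof (rule cINF_greatest[OF ne])
      fix q assume q: "q \<in> K"
      show "c * (INF q\<in>K. q x) \<le> q (c *\<^sub>R x)"
        using low[OF q, of x] K[OF q] that sublinear_scale[of q c x] by simp
    qed
    have "inverse c * (INF q\<in>K. q (c *\<^sub>R x)) \<le> (INF q\<in>K. q x)"
      using 1[of "inverse c" "c *\<^sub>R x"] c by simp
    then have "(INF q\<in>K. q (c *\<^sub>R x)) \<le> c * (INF q\<in>K. q x)"
      using c by (simp add: field_simps)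
    with 1[OF c, of x] show "(INF q\<in>K. q (c *\<^sub>R x)) = c * (INF q\<in>K. q x)" by linarith
  qed
qed

text \<open>If \<open>q\<close> is minimal, its shift \<open>r\<close> along \<open>a\<close> agrees
  with it, and the last claim then gives \<open>q x + q a \<le> q (x + a)\<close>, the missing half
  of additivity.\<close>

lemma sublinear_INF_shift:
  fixes q :: "'a::real_vector \<Rightarrow> real" and a :: 'a
  assumes q: "sublinear q"
  defines "r \<equiv> \<lambda>x. INF t\<in>{0<..}. q (x + t *\<^sub>R a) - t * q a"
  shows "sublinear r" "r x \<le> q x" "r x \<le> q (x + a) - q a"
proof -
  have ta: "q (t *\<^sub>R a) = t * q a" if "t > 0" for t :: real using sublinear_scale[OF q that] .
  have lo: "- q (- x) \<le> q (x + t *\<^sub>R a) - t * q a" if "t > 0" for t x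
    using sublinear_add[OF q, of "x + t *\<^sub>R a" "- x"] ta[OF that] by simp
  have bdd: "bdd_below ((\<lambda>t. q (x + t *\<^sub>R a) - t * q a) ` {0<..})" for x
    by (rule bdd_belowI2[where m = "- q (- x)"]) (use lo in auto)
  have low: "r x \<le> q (x + t *\<^sub>R a) - t * q a" if "t > 0" for t x
    unfolding r_def by (rule cINF_lower[OF bdd]) (use that in simp)
  have gr: "m \<le> r x" if "\<And>t. t > 0 \<Longrightarrow> m \<le> q (x + t *\<^sub>R a) - t * q a" for m x
    unfolding r_def by (rule cINF_greatest) (use that in auto)
  show "r x \<le> q (x + a) - q a" using low[of 1 x] by simp
  show "r x \<le> q x" using low[of 1 x] sublinear_add[OF q, of x a] by simp
  show "sublinear r"
    unfolding sublinear_def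
  proof (intro conjI allI impI)
    fix x y
    have sum: "r (x + y) \<le> (q (x + t *\<^sub>R a) - t * q a) + (q (y + s *\<^sub>R a) - s * q a)"
      if "t > 0" "s > 0" for t s
      using low[of "t + s" "x + y"] that sublinear_add[OF q, of "x + t *\<^sub>R a" "y + s *\<^sub>R a"]
      by (simp add: algebra_simps)
    have "r (x + y) - (q (y + s *\<^sub>R a) - s * q a) \<le> r x" if "s > 0" for s
      by (rule gr) (use sum[OF _ that] in \<open>simp add: algebra_simps\<close>)
    then have "r (x + y) - r x \<le> r y"
      by (intro gr) (simp add: algebra_simps)
    then show "r (x + y) \<le> r x + r y" by simp
  next
    fix c :: real and x assume c: "c > 0"
    have 1: "c * r x \<le> r (c *\<^sub>R x)" if c: "c > 0" for c x
    proof (rule gr)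
      fix t :: real assume t: "t > 0"
      have "q (c *\<^sub>R x + t *\<^sub>R a) = c * q (x + (t / c) *\<^sub>R a)"
        using sublinear_scale[OF q c, of "x + (t / c) *\<^sub>R a"] c by (simp add: scaleR_add_right)
      moreover have "c * r x \<le> c * (q (x + (t / c) *\<^sub>R a) - (t / c) * q a)"
        using low[of "t / c" x] t c by simp
      ultimately show "c * r x \<le> q (c *\<^sub>R x + t *\<^sub>R a) - t * q a"
        using c by (simp add: right_diff_distrib)
    qed
    have "inverse c * r (c *\<^sub>R x) \<le> r x" using 1[of "inverse c" "c *\<^sub>R x"] c by simp
    then have "r (c *\<^sub>R x) \<le> c * r x" using c by (simp add: field_simps)
    with 1[OF c, of x] show "r (c *\<^sub>R x) = c * r x" by linarith
  qed
qed

text \<open>A minimal sublinear functional is linear, since it coincides with each of its shifts.\<close>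

theorem Hahn_Banach_sublinear:
  fixes P :: "'a::real_vector \<Rightarrow> real"
  assumes P: "sublinear P"
  obtains L where "linear L" "\<And>x. L x \<le> P x"
proof -
  let ?A = "{q. sublinear q \<and> (\<forall>x. q x \<le> P x)}"
  \<comment> \<open>The order is reversed, so that a maximal element for Zorn is a minimal sublinear
    functional.\<close>
  let ?R = "\<lambda>q r. \<forall>x. (r x :: real) \<le> q x"
  have po: "partial_order_on ?A (relation_of ?R ?A)"
    by (rule partial_order_on_relation_ofI) (auto intro!: ext intro: order_trans antisym)
  have "\<exists>m\<in>?A. \<forall>a\<in>?A. ?R m a \<longrightarrow> a = m"
  proof (rule predicate_Zorn[OF po])
    fix K assume K: "K \<in> Chains (relation_of ?R ?A)"
    show "\<exists>u\<in>?A. \<forall>a\<in>K. ?R a u"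
    proof (cases "K = {}")
      case True then show ?thesis using P by auto
    next
      case False
      have sub: "\<And>q. q \<in> K \<Longrightarrow> sublinear q \<and> (\<forall>x. q x \<le> P x)"
        using Chains_relation_of[OF K] by auto
      have chain: "(\<forall>x. q x \<le> r x) \<or> (\<forall>x. r x \<le> q x)" if "q \<in> K" "r \<in> K" for q r
        using K that unfolding Chains_def relation_of_def by blast
      have sub_inf: "sublinear (\<lambda>x. INF q\<in>K. q x)"
        by (rule sublinear_INF_chain(1)[of K P]) (fact False | erule sub | erule (1) chain)+
      have inf_le: "(INF q\<in>K. q x) \<le> q x" if q: "q \<in> K" for q x
        by (rule sublinear_INF_chain(2)[of K P]) (fact False | fact q | erule sub | erule (1) chain)+
      obtain q0 where q0: "q0 \<in> K" using False by blast
      have "(INF q\<in>K. q x) \<le> P x" for x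
        by (rule order.trans[OF inf_le[OF q0]]) (use sub[OF q0] in simp)
      then show ?thesis
        by (intro bexI[where x = "\<lambda>x. INF q\<in>K. q x"] ballI allI inf_le)
          (use sub_inf in simp_all)
    qed
  qed
  then obtain L where L: "sublinear L" "\<And>x. L x \<le> P x"
    and min: "\<And>q. sublinear q \<Longrightarrow> (\<forall>x. q x \<le> L x) \<Longrightarrow> q = L"
    by simp (metis order_trans)
  have add: "L (x + a) = L x + L a" for x a
  proof -
    let ?r = "\<lambda>x. INF t\<in>{0<..}. L (x + t *\<^sub>R a) - t * L a"
    have r: "?r = L" using sublinear_INF_shift(1,2)[OF L(1), where a = a] by (intro min) auto
    have "?r x \<le> L (x + a) - L a" by (rule sublinear_INF_shift(3)[OF L(1)])
    then have "L x \<le> L (x + a) - L a" unfolding fun_cong[OF r] .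
    then show ?thesis using sublinear_add[OF L(1), of x a] by simp
  qed
  have neg: "L (- x) = - L x" for x using add[of x "- x"] sublinear_0[OF L(1)] by simp
  have "linear L"
  proof (rule linearI)
    show "L (c *\<^sub>R x) = c *\<^sub>R L x" for c x
    proof (cases c "0::real" rule: linorder_cases)
      case less
      then show ?thesis using sublinear_scale[OF L(1), of "- c" x] neg[of "c *\<^sub>R x"] by simp
    next
      case equal then show ?thesis using sublinear_0[OF L(1)] by simp
    next
      case greater then show ?thesis using sublinear_scale[OF L(1)] by simp
    qed
  qed (rule add)
  then show thesis using L(2) that by blast
qed

text \<open>\<open>P\<close> is the directional derivative of \<open>f\<close> at 0, an infimum of
  difference quotients. Convexity makes it sublinear, Hahn-Banach puts a linear \<open>L\<close>
  below it, and the quotient at \<open>t = 1\<close> gives the subgradient inequality.\<close>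

theorem convex_subgradient_at_0:
  fixes f :: "'a::real_vector \<Rightarrow> real"
  assumes f: "convex_on UNIV f"
  obtains L where "linear L" "\<And>x. f 0 + L x \<le> f x"
proof -
  define P where "P x = (INF t\<in>{0<..}. (f (t *\<^sub>R x) - f 0) / t)" for x
  \<comment> \<open>The step \<open>s * t / (s + t)\<close> is chosen so that the difference
    quotient at \<open>x + y\<close> is at most the sum of those at \<open>x\<close> with step
    \<open>s\<close> and at \<open>y\<close> with step \<open>t\<close>.\<close>
  have comb: "(s + t) * f ((s * t / (s + t)) *\<^sub>R (x + y)) \<le> t * f (s *\<^sub>R x) + s * f (t *\<^sub>R y)"
    if "s > 0" "t > 0" for s t x y
  proof -
    have "f ((t / (s + t)) *\<^sub>R (s *\<^sub>R x) + (s / (s + t)) *\<^sub>R (t *\<^sub>R y))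
        \<le> t / (s + t) * f (s *\<^sub>R x) + s / (s + t) * f (t *\<^sub>R y)"
      using that by (intro convex_on_UNIV_D[OF f]) (auto simp: add_divide_distrib[symmetric])
    also have "(t / (s + t)) *\<^sub>R (s *\<^sub>R x) + (s / (s + t)) *\<^sub>R (t *\<^sub>R y) = (s * t / (s + t)) *\<^sub>R (x + y)"
      by (simp add: scaleR_add_right mult.commute)
    finally have "(s + t) * f ((s * t / (s + t)) *\<^sub>R (x + y))
        \<le> (s + t) * (t / (s + t) * f (s *\<^sub>R x) + s / (s + t) * f (t *\<^sub>R y))"
      using that by (intro mult_left_mono) auto
    also have "\<dots> = t * f (s *\<^sub>R x) + s * f (t *\<^sub>R y)"
      using that by (simp add: distrib_left)
    finally show ?thesis .
  qed
  have lo: "- (f (- x) - f 0) \<le> (f (t *\<^sub>R x) - f 0) / t" if "t > 0" for t x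
    using comb[of t 1 x "- x"] that by (simp add: field_simps)
  have bdd: "bdd_below ((\<lambda>t. (f (t *\<^sub>R x) - f 0) / t) ` {0<..})" for x
    by (rule bdd_belowI2) (use lo in auto)
  have low: "P x \<le> (f (t *\<^sub>R x) - f 0) / t" if "t > 0" for t x
    unfolding P_def by (rule cINF_lower[OF bdd]) (use that in simp)
  have gr: "m \<le> P x" if "\<And>t. t > 0 \<Longrightarrow> m \<le> (f (t *\<^sub>R x) - f 0) / t" for m x
    unfolding P_def by (rule cINF_greatest) (use that in auto)
  have "sublinear P"
    unfolding sublinear_def
  proof (intro conjI allI impI)
    fix x y
    have sum: "P (x + y) \<le> (f (s *\<^sub>R x) - f 0) / s + (f (t *\<^sub>R y) - f 0) / t"
      if "s > 0" "t > 0" for s t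
    proof -
      let ?u = "s * t / (s + t)"
      have "P (x + y) \<le> (f (?u *\<^sub>R (x + y)) - f 0) / ?u"
        using that by (intro low) simp
      also have "\<dots> = ((s + t) * f (?u *\<^sub>R (x + y)) - (s + t) * f 0) / (s * t)"
        using that by (simp add: field_simps)
      also have "\<dots> \<le> (t * f (s *\<^sub>R x) + s * f (t *\<^sub>R y) - (s + t) * f 0) / (s * t)"
        using comb[OF that, of x y] that by (intro divide_right_mono) auto
      also have "\<dots> = (f (s *\<^sub>R x) - f 0) / s + (f (t *\<^sub>R y) - f 0) / t"
        using that by (simp add: field_simps)
      finally show ?thesis .
    qed
    have "P (x + y) - (f (t *\<^sub>R y) - f 0) / t \<le> P x" if "t > 0" for t
      by (rule gr) (use sum[OF _ that] in \<open>simp add: algebra_simps\<close>)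
    then have "P (x + y) - P x \<le> P y"
      by (intro gr) (simp add: algebra_simps)
    then show "P (x + y) \<le> P x + P y" by simp
  next
    fix c :: real and x assume c: "c > 0"
    have 1: "c * P x \<le> P (c *\<^sub>R x)" if c: "c > 0" for c x
    proof (rule gr)
      fix t :: real assume t: "t > 0"
      show "c * P x \<le> (f (t *\<^sub>R c *\<^sub>R x) - f 0) / t"
        using low[of "t * c" x] t c by (simp add: field_simps)
    qed
    have "inverse c * P (c *\<^sub>R x) \<le> P x" using 1[of "inverse c" "c *\<^sub>R x"] c by simp
    then have "P (c *\<^sub>R x) \<le> c * P x" using c by (simp add: field_simps)
    with 1[OF c, of x] show "P (c *\<^sub>R x) = c * P x" by linarith
  qed
  then obtain L where L: "linear L" "\<And>x. L x \<le> P x" using Hahn_Banach_sublinear by blast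
  have "f 0 + L x \<le> f x" for x using L(2)[of x] low[of 1 x] by simp
  then show thesis using L(1) that by blast
qed

text \<open>A step of length \<open>d / 2\<close> from \<open>x0\<close> along \<open>x\<close>
  stays in the ball, which bounds \<open>L x\<close> by a multiple of \<open>norm x\<close>; the
  direction \<open>- x\<close> gives the bound from below.\<close>

lemma linear_bounded_above_imp_bounded_linear:
  fixes L :: "'a::real_normed_vector \<Rightarrow> real"
  assumes L: "linear L" and d: "d > 0" and M: "\<And>x. norm (x - x0) < d \<Longrightarrow> L x \<le> M"
  shows "bounded_linear L"
proof -
  define K where "K = (2 / d) * (M - L x0)"
  have main: "L x \<le> norm x * K" for x
  proof (cases "x = 0")
    case True then show ?thesis using linear_0[OF L] by simp
  next
    case False
    let ?y = "x0 + (d / 2 / norm x) *\<^sub>R x"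
    have "L ?y \<le> M" by (rule M) (use False d in simp)
    then have "(d / 2 / norm x) * L x \<le> M - L x0"
      by (simp add: linear_add[OF L] linear_scale[OF L])
    then show ?thesis using False d by (simp add: K_def field_simps)
  qed
  have "\<bar>L x\<bar> \<le> norm x * K" for x
    using main[of x] main[of "- x"] linear_neg[OF L, of x] by simp
  then show ?thesis
    using L by (intro bounded_linear_intro[of L K]) (auto simp: linear_add linear_scale)
qed

text \<open>The subgradient at 0 of the value function \<^term>\<open>\<lambda>w. INF (d, r)\<in>D. r + k (d + w)\<close>
  solves the dual problem.\<close>

theorem Fenchel_duality:
  fixes D :: "('a::real_normed_vector \<times> real) set" and k :: "'a \<Rightarrow> real"
  assumes D: "convex D" "D \<noteq> {}" and k: "convex_on UNIV k"
    and bd: "d0 > 0" "\<And>x. norm (x - x0) < d0 \<Longrightarrow> k x \<le> M"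
    and weak: "\<And>d r. (d, r) \<in> D \<Longrightarrow> 0 \<le> r + k d"
  obtains L where "bounded_linear L" "\<And>d r v. (d, r) \<in> D \<Longrightarrow> 0 \<le> r + L d + k v - L v"
proof -
  define f where "f w = (INF (d, r)\<in>D. r + k (d + w))" for w
  obtain d1 r1 where d1: "(d1, r1) \<in> D" using D by auto
  \<comment> \<open>Weak duality at the midpoint of \<open>d\<close> and \<open>d1\<close>, where
    the shifts \<open>w\<close> and \<open>- w\<close> cancel, bounds the infimum defining
    \<open>f w\<close> from below.\<close>
  have pair: "- (r1 + k (d1 - w)) \<le> r + k (d + w)" if "(d, r) \<in> D" for d r w
  proof -
    have "((1/2) *\<^sub>R d + (1/2) *\<^sub>R d1, (1/2) * r + (1/2) * r1) \<in> D"
      using convexD[OF D(1) that d1, of "1/2" "1/2"] by simp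
    from weak[OF this] have "0 \<le> (1/2) * r + (1/2) * r1 + k ((1/2) *\<^sub>R (d + w) + (1/2) *\<^sub>R (d1 - w))"
      by (simp add: algebra_simps)
    also have "k ((1/2) *\<^sub>R (d + w) + (1/2) *\<^sub>R (d1 - w)) \<le> 1/2 * k (d + w) + 1/2 * k (d1 - w)"
      by (rule convex_on_UNIV_D[OF k]) auto
    finally show ?thesis by simp
  qed
  have bdd: "bdd_below ((\<lambda>(d, r). r + k (d + w)) ` D)" for w
    using pair by (intro bdd_belowI2[where m = "- (r1 + k (d1 - w))"]) auto
  have low: "f w \<le> r + k (d + w)" if "(d, r) \<in> D" for d r w
    unfolding f_def using cINF_lower[OF bdd that] by simp
  have gr: "m \<le> f w" if "\<And>d r. (d, r) \<in> D \<Longrightarrow> m \<le> r + k (d + w)" for m w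
    unfolding f_def by (rule cINF_greatest[OF D(2)]) (use that in auto)
  have "convex_on UNIV f"
  proof (rule convex_onI)
    fix t :: real and x y :: 'a assume t: "0 < t" "t < 1"
    have both: "f ((1 - t) *\<^sub>R x + t *\<^sub>R y) \<le> (1 - t) * (r + k (d + x)) + t * (s + k (e + y))"
      if "(d, r) \<in> D" "(e, s) \<in> D" for d r e s
    proof -
      have "((1 - t) *\<^sub>R d + t *\<^sub>R e, (1 - t) * r + t * s) \<in> D"
        using convexD[OF D(1) that, of "1 - t" t] t by simp
      from low[OF this, of "(1 - t) *\<^sub>R x + t *\<^sub>R y"]
      have "f ((1 - t) *\<^sub>R x + t *\<^sub>R y) \<le> (1 - t) * r + t * s + k ((1 - t) *\<^sub>R (d + x) + t *\<^sub>R (e + y))"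
        by (simp add: algebra_simps)
      also have "k ((1 - t) *\<^sub>R (d + x) + t *\<^sub>R (e + y)) \<le> (1 - t) * k (d + x) + t * k (e + y)"
        using convex_onD[OF k, of t] t by simp
      finally show ?thesis by (simp add: algebra_simps)
    qed
    have 1: "(f ((1 - t) *\<^sub>R x + t *\<^sub>R y) - t * (s + k (e + y))) / (1 - t) \<le> f x" if "(e, s) \<in> D" for e s
      by (rule gr) (use both[OF _ that] t in \<open>simp add: field_simps\<close>)
    have "(f ((1 - t) *\<^sub>R x + t *\<^sub>R y) - (1 - t) * f x) / t \<le> f y"
      by (rule gr) (use 1 t in \<open>simp add: field_simps\<close>)
    then show "f ((1 - t) *\<^sub>R x + t *\<^sub>R y) \<le> (1 - t) * f x + t * f y"
      using t by (simp add: field_simps)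
  qed simp
  then obtain L where L: "linear L" "\<And>x. f 0 + L x \<le> f x" using convex_subgradient_at_0 by blast
  have f0: "0 \<le> f 0" by (rule gr) (use weak in auto)
  have up: "L w \<le> r + k (d + w)" if "(d, r) \<in> D" for d r w
    using L(2)[of w] f0 low[OF that, of w] by linarith
  \<comment> \<open>Through the point \<open>d1\<close>, the bound on \<open>k\<close> around
    \<open>x0\<close> becomes one on \<open>L\<close> around \<open>x0 - d1\<close>.\<close>
  have "bounded_linear L"
  proof (rule linear_bounded_above_imp_bounded_linear[OF L(1) bd(1)])
    fix x assume "norm (x - (x0 - d1)) < d0"
    then have "k (d1 + x) \<le> M" by (intro bd(2)) (simp add: algebra_simps)
    then show "L x \<le> r1 + M" using up[OF d1, of x] by simp
  qed
  \<comment> \<open>The choice \<open>w = v - d\<close> moves the argument of \<open>k\<close> to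
    \<open>v\<close>.\<close>
  moreover have "0 \<le> r + L d + k v - L v" if "(d, r) \<in> D" for d r v
    using up[OF that, of "v - d"] by (simp add: linear_diff[OF L(1)])
  ultimately show thesis using that by blast
qed

text \<open>The closed sets \<open>U n\<close>, on which all \<open>a i\<close> are at most
  \<open>n\<close>, cover a complete space, so by Baire one of them contains a ball.\<close>

theorem SUP_affine_locally_bounded:
  fixes a :: "'i \<Rightarrow> 'e::banach \<Rightarrow> real"
  assumes cont: "\<And>i. i \<in> I \<Longrightarrow> continuous_on UNIV (a i)"
    and bdd: "\<And>x. bdd_above ((\<lambda>i. a i x) ` I)"
  obtains x0 d M where "d > 0" "\<And>x i. norm (x - x0) < d \<Longrightarrow> i \<in> I \<Longrightarrow> a i x \<le> M"
proof -
  define U where "U n = {x. \<forall>i\<in>I. a i x \<le> real n}" for n :: nat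
  have cl: "closed (U n)" for n
  proof -
    have "closed {x. a i x \<le> real n}" if "i \<in> I" for i
      using cont[OF that] by (intro closed_Collect_le) auto
    then have "closed (\<Inter>i\<in>I. {x. a i x \<le> real n})" by auto
    moreover have "U n = (\<Inter>i\<in>I. {x. a i x \<le> real n})" by (auto simp: U_def)
    ultimately show ?thesis by simp
  qed
  have un: "(\<Union>n. U n) = UNIV"
  proof (safe; simp)
    fix x
    obtain B where B: "\<And>i. i \<in> I \<Longrightarrow> a i x \<le> B" using bdd[of x] by (auto simp: bdd_above_def)
    obtain n where "B \<le> real n" using real_arch_simple by blast
    then show "\<exists>n. x \<in> U n" using B order_trans unfolding U_def by blast
  qed
  have "\<exists>n. interior (U n) \<noteq> {}"
  proof (rule ccontr)
    assume "\<not> ?thesis"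
    then have "euclidean interior_of \<Union>(range U) = {}"
      by (intro Baire_category_alt) (use cl in \<open>auto simp: completely_metrizable_space_euclidean\<close>)
    then show False using un by simp
  qed
  then obtain n x0 where "x0 \<in> interior (U n)" by blast
  then obtain d where "d > 0" "ball x0 d \<subseteq> U n" by (auto simp: mem_interior)
  then show thesis
    by (intro that[of d x0 "real n"]) (auto simp: U_def subset_iff dist_norm norm_minus_commute)
qed

subsection \<open>Banach spaces self-dual under a symmetric form\<close>

lemma convex_on_norm_power2: "convex_on UNIV (\<lambda>x::'a::real_normed_vector. (norm x)\<^sup>2)"
proof (rule convex_onI)
  fix t :: real and x y :: 'a assume t: "0 < t" "t < 1"
  have "norm ((1 - t) *\<^sub>R x + t *\<^sub>R y) \<le> (1 - t) * norm x + t * norm y"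
    using norm_triangle_ineq[of "(1 - t) *\<^sub>R x" "t *\<^sub>R y"] t by simp
  then have "(norm ((1 - t) *\<^sub>R x + t *\<^sub>R y))\<^sup>2 \<le> ((1 - t) * norm x + t * norm y)\<^sup>2"
    by (rule power_mono) simp
  also have "\<dots> \<le> (1 - t) * (norm x)\<^sup>2 + t * (norm y)\<^sup>2"
    using convex_onD[OF convex_power2, of t "norm x" "norm y"] t by simp
  finally show "(norm ((1 - t) *\<^sub>R x + t *\<^sub>R y))\<^sup>2 \<le> (1 - t) * (norm x)\<^sup>2 + t * (norm y)\<^sup>2" .
qed simp

lemma convex_on_compose_linear:
  assumes "convex_on UNIV f" "linear g"
  shows "convex_on UNIV (\<lambda>x. f (g x))"
  using assms by (simp add: convex_on_def linear_add linear_scale)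

text \<open>\<open>norming\<close> says that half the squared norm is at most its own conjugate
  under \<open>B\<close>, up to \<open>\<epsilon>\<close>; \<open>bound\<close> gives the reverse
  inequality.\<close>

locale symmetric_dual = B: bounded_bilinear B
  for B :: "'e::banach \<Rightarrow> 'e \<Rightarrow> real" +
  assumes sym: "B e f = B f e"
    and bound: "B e f \<le> norm e * norm f"
    and represent: "bounded_linear L \<Longrightarrow> \<exists>a. L = (\<lambda>e. B e a)"
    and norming: "\<epsilon> > 0 \<Longrightarrow> \<exists>f. (norm d)\<^sup>2 / 2 - \<epsilon> \<le> B f d - (norm f)\<^sup>2 / 2"
begin

definition q :: "'e \<Rightarrow> real" where "q e = B e e / 2"

lemma q_diff: "q (e - f) = q e - B e f + q f"
  by (simp add: q_def B.diff_left B.diff_right sym[of f e] field_simps)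

lemma q_midpoint: "q ((1/2) *\<^sub>R (e + f)) = (q e + B e f + q f) / 4"
  by (simp add: q_def B.add_left B.add_right B.scaleR_left B.scaleR_right sym[of f e] field_simps)

lemma q_le: "q e \<le> (norm e)\<^sup>2 / 2"
  using bound[of e e] by (simp add: q_def power2_eq_square)

text \<open>By polarisation \<open>q\<close> at the midpoint is
  \<open>B y z / 2 + q (y - z) / 4\<close>, and \<open>q_le\<close> bounds the last term. The
  resulting weight 1/8 is the one in Psi.\<close>

lemma q_midpoint_le: "q ((1/2) *\<^sub>R (y + z)) \<le> B y z / 2 + (norm (y - z))\<^sup>2 / 8"
  using q_le[of "y - z"] by (simp add: q_midpoint q_diff)

text \<open>The Fitzpatrick function of \<open>G\<close>, its conjugate and the function \<open>\<Psi>\<close> are represented by their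
  real epigraphs, which avoids extended real arithmetic.\<close>

definition Phi_epi :: "'e set \<Rightarrow> ('e \<times> real) set" where
  "Phi_epi G = {(e, r). \<forall>g\<in>G. B e g - q g \<le> r}"

definition conj_epi :: "('e \<times> real) set \<Rightarrow> ('e \<times> real) set" where
  "conj_epi S = {(z, s). \<forall>(e, r)\<in>S. B e z - r \<le> s}"

text \<open>Membership demands a witness pair \<open>y\<close>, \<open>z\<close>, whereas Psi is an
  infimum; hence the slack \<open>\<epsilon>\<close> when a value of Psi is turned into
  membership.\<close>

definition avg_epi :: "('e \<times> real) set \<Rightarrow> ('e \<times> real) set \<Rightarrow> ('e \<times> real) set" where
  "avg_epi S R = {(u, r). \<exists>y z s t. y + z = 2 *\<^sub>R u \<and> (y, s) \<in> S \<and> (z, t) \<in> R \<and>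
     (s + t) / 2 + (norm (y - z))\<^sup>2 / 8 \<le> r}"

abbreviation Psi_epi :: "'e set \<Rightarrow> ('e \<times> real) set" where
  "Psi_epi G \<equiv> avg_epi (Phi_epi G) (conj_epi (Phi_epi G))"

section \<open>Convexity of the three epigraphs\<close>

lemma convex_Phi_epi: "convex (Phi_epi G)"
proof (rule convexI, clarsimp simp: Phi_epi_def)
  fix x y g and r s u v :: real
  assume "\<forall>g\<in>G. B x g - q g \<le> r" "\<forall>g\<in>G. B y g - q g \<le> s" "g \<in> G"
    and uv: "0 \<le> u" "0 \<le> v" "u + v = 1"
  then have "u * (B x g - q g) + v * (B y g - q g) \<le> u * r + v * s"
    by (intro add_mono mult_left_mono) auto
  moreover have "u * (B x g - q g) + v * (B y g - q g) = u * B x g + v * B y g - (u + v) * q g"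
    by (simp add: algebra_simps)
  ultimately show "B (u *\<^sub>R x + v *\<^sub>R y) g - q g \<le> u * r + v * s"
    using uv by (simp add: B.add_left B.scaleR_left)
qed

lemma convex_conj_epi: "convex (conj_epi S)"
proof (rule convexI, clarsimp simp: conj_epi_def)
  fix x y e and r s t u v :: real
  assume "\<forall>(e, t)\<in>S. B e x - t \<le> r" "\<forall>(e, t)\<in>S. B e y - t \<le> s" "(e, t) \<in> S"
    and uv: "0 \<le> u" "0 \<le> v" "u + v = 1"
  then have "u * (B e x - t) + v * (B e y - t) \<le> u * r + v * s"
    by (intro add_mono mult_left_mono) auto
  moreover have "u * (B e x - t) + v * (B e y - t) = u * B e x + v * B e y - (u + v) * t"
    by (simp add: algebra_simps)
  ultimately show "B e (u *\<^sub>R x + v *\<^sub>R y) - t \<le> u * r + v * s"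
    using uv by (simp add: B.add_right B.scaleR_right)
qed

lemma convex_avg_epi:
  assumes "convex S" "convex R"
  shows "convex (avg_epi S R)"
proof (rule convexI)
  fix a b :: "'e \<times> real" and t t' :: real
  assume a: "a \<in> avg_epi S R" and b: "b \<in> avg_epi S R"
    and t: "0 \<le> t" "0 \<le> t'" "t + t' = 1"
  obtain u r y z m n where a': "a = (u, r)" "y + z = 2 *\<^sub>R u" "(y, m) \<in> S" "(z, n) \<in> R"
    "(m + n) / 2 + (norm (y - z))\<^sup>2 / 8 \<le> r"
    using a by (auto simp: avg_epi_def)
  obtain u' r' y' z' m' n' where b': "b = (u', r')" "y' + z' = 2 *\<^sub>R u'" "(y', m') \<in> S" "(z', n') \<in> R"
    "(m' + n') / 2 + (norm (y' - z'))\<^sup>2 / 8 \<le> r'"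
    using b by (auto simp: avg_epi_def)
  have 1: "(t *\<^sub>R y + t' *\<^sub>R y', t * m + t' * m') \<in> S"
    using convexD[OF assms(1) a'(3) b'(3) t] by simp
  have 2: "(t *\<^sub>R z + t' *\<^sub>R z', t * n + t' * n') \<in> R"
    using convexD[OF assms(2) a'(4) b'(4) t] by simp
  have 3: "(t *\<^sub>R y + t' *\<^sub>R y') + (t *\<^sub>R z + t' *\<^sub>R z') = 2 *\<^sub>R (t *\<^sub>R u + t' *\<^sub>R u')"
  proof -
    have "(t *\<^sub>R y + t' *\<^sub>R y') + (t *\<^sub>R z + t' *\<^sub>R z') = t *\<^sub>R (y + z) + t' *\<^sub>R (y' + z')"
      by (simp add: algebra_simps)
    then show ?thesis unfolding a'(2) b'(2) by (simp add: scaleR_add_right mult.commute)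
  qed
  have "(norm ((t *\<^sub>R y + t' *\<^sub>R y') - (t *\<^sub>R z + t' *\<^sub>R z')))\<^sup>2 \<le> t * (norm (y - z))\<^sup>2 + t' * (norm (y' - z'))\<^sup>2"
    using convex_on_UNIV_D[OF convex_on_norm_power2 t, of "y - z" "y' - z'"] by (simp add: algebra_simps)
  moreover have "t * ((m + n) / 2 + (norm (y - z))\<^sup>2 / 8) + t' * ((m' + n') / 2 + (norm (y' - z'))\<^sup>2 / 8) \<le> t * r + t' * r'"
    using a'(5) b'(5) t by (intro add_mono mult_left_mono) auto
  ultimately have "((t * m + t' * m') + (t * n + t' * n')) / 2
      + (norm ((t *\<^sub>R y + t' *\<^sub>R y') - (t *\<^sub>R z + t' *\<^sub>R z')))\<^sup>2 / 8 \<le> t * r + t' * r'"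
    by (simp add: field_simps)
  with 1 2 3 show "t *\<^sub>R a + t' *\<^sub>R b \<in> avg_epi S R"
    unfolding a'(1) b'(1) avg_epi_def by (simp only: scaleR_Pair add_Pair real_scaleR_def mem_Collect_eq case_prod_conv) blast
qed

section \<open>The contact set of Psi and \<open>q\<close>\<close>

lemma Phi_epi_self:
  assumes "\<And>g h. g \<in> G \<Longrightarrow> h \<in> G \<Longrightarrow> 0 \<le> q (g - h)" "g \<in> G"
  shows "(g, q g) \<in> Phi_epi G"
  using assms q_diff by (fastforce simp: Phi_epi_def)

lemma conj_Phi_epi_self: "g \<in> G \<Longrightarrow> (g, q g) \<in> conj_epi (Phi_epi G)"
  by (force simp: conj_epi_def Phi_epi_def)

text \<open>Fenchel-Young for Phi and its conjugate gives \<open>B y z \<le> s + t\<close>;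
  \<open>q_midpoint_le\<close> does the rest.\<close>

lemma Psi_epi_ge: "(u, r) \<in> Psi_epi G \<Longrightarrow> q u \<le> r"
proof -
  assume "(u, r) \<in> Psi_epi G"
  then obtain y z s t where *: "y + z = 2 *\<^sub>R u" "(y, s) \<in> Phi_epi G" "(z, t) \<in> conj_epi (Phi_epi G)"
    "(s + t) / 2 + (norm (y - z))\<^sup>2 / 8 \<le> r" by (auto simp: avg_epi_def)
  have "B y z - s \<le> t" using *(2,3) by (auto simp: conj_epi_def)
  then have "B y z / 2 + (norm (y - z))\<^sup>2 / 8 \<le> (s + t) / 2 + (norm (y - z))\<^sup>2 / 8" by simp
  also note *(4)
  finally show ?thesis using q_midpoint_le[of y z] *(1) by simp
qed

text \<open>On \<open>G\<close>, Phi is at most \<open>q\<close> by monotonicity and its conjugate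
  is at most \<open>q\<close> by the definition of Phi; for \<open>y = z = g\<close> the norm term
  vanishes.\<close>

lemma Psi_epi_self:
  assumes "\<And>g h. g \<in> G \<Longrightarrow> h \<in> G \<Longrightarrow> 0 \<le> q (g - h)" "g \<in> G"
  shows "(g, q g) \<in> Psi_epi G"
proof -
  have "g + g = 2 *\<^sub>R g" by (simp add: scaleR_2)
  then show ?thesis
    using Phi_epi_self[of G g] conj_Phi_epi_self[of g G] assms
    unfolding avg_epi_def by fastforce
qed

text \<open>Convexity of Psi bounds \<open>q\<close> at the midpoint by
  \<open>(q u + q v) / 2 + \<epsilon> / 4\<close>; expanding the quadratic form, this says
  \<open>q (u - v) \<ge> - \<epsilon>\<close>.\<close>

lemma Psi_contact_positive:
  assumes u: "\<And>\<epsilon>. \<epsilon> > 0 \<Longrightarrow> (u, q u + \<epsilon>) \<in> Psi_epi G"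
    and v: "\<And>\<epsilon>. \<epsilon> > 0 \<Longrightarrow> (v, q v + \<epsilon>) \<in> Psi_epi G"
  shows "0 \<le> q (u - v)"
proof (rule field_le_epsilon)
  fix \<epsilon> :: real assume "\<epsilon> > 0"
  then have \<epsilon>: "\<epsilon> / 4 > 0" by simp
  have "(1/2) *\<^sub>R (u, q u + \<epsilon> / 4) + (1/2) *\<^sub>R (v, q v + \<epsilon> / 4) \<in> Psi_epi G"
    by (rule convexD[OF convex_avg_epi[OF convex_Phi_epi convex_conj_epi] u[OF \<epsilon>] v[OF \<epsilon>]]) auto
  also have "(1/2) *\<^sub>R (u, q u + \<epsilon> / 4) + (1/2) *\<^sub>R (v, q v + \<epsilon> / 4) = ((1/2) *\<^sub>R (u + v), (q u + q v) / 2 + \<epsilon> / 4)"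
    by (simp add: scaleR_add_right field_simps)
  finally have "((1/2) *\<^sub>R (u + v), (q u + q v) / 2 + \<epsilon> / 4) \<in> Psi_epi G" .
  from Psi_epi_ge[OF this] show "0 \<le> q (u - v) + \<epsilon>"
    unfolding q_midpoint q_diff by argo
qed

text \<open>The hypotheses on \<open>N\<close> abstract the graph of
  \<open>\<lambda>t. F x - F t\<close>: monotonicity of \<open>F\<close> with the sign reversed,
  maximality and 3*-monotonicity. The point \<open>u\<close> is read off from a dual
  solution.\<close>

theorem Psi_contact_exists:
  assumes G: "G \<noteq> {}" "\<And>g h. g \<in> G \<Longrightarrow> h \<in> G \<Longrightarrow> 0 \<le> q (g - h)"
    and N: "\<And>m n. m \<in> N \<Longrightarrow> n \<in> N \<Longrightarrow> q (m - n) \<le> 0"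
    and N_max: "\<And>e. \<exists>n\<in>N. 0 \<le> q (e - n)"
    and N_bdd: "\<And>e. bdd_above ((\<lambda>n. q (e - n)) ` N)"
  obtains u where "(u, q u) \<in> Psi_epi G" "\<And>n. n \<in> N \<Longrightarrow> q (u - n) \<le> 0"
proof -
  have N_ne: "N \<noteq> {}" using N_max by blast
  \<comment> \<open>Since \<open>q n - B e n = q (e - n) - q e\<close>, \<open>N_bdd\<close> makes
    \<open>k\<close> finite, \<open>N_max\<close> gives \<open>k \<ge> - q\<close>, and
    \<open>N\<close> gives \<open>k \<le> - q\<close> on \<open>N\<close>.\<close>
  define k where "k e = (SUP n\<in>N. q n - B e n)" for e
  have bdd: "bdd_above ((\<lambda>n. q n - B e n) ` N)" for e
  proof -
    obtain M where "\<And>n. n \<in> N \<Longrightarrow> q (e - n) \<le> M" using N_bdd[of e] by (auto simp: bdd_above_def)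
    then have "q n - B e n \<le> M - q e" if "n \<in> N" for n using that by (fastforce simp: q_diff)
    then show ?thesis by (rule bdd_aboveI2)
  qed
  have k_ge: "q n - B e n \<le> k e" if "n \<in> N" for e n
    unfolding k_def by (rule cSUP_upper[OF that bdd])
  have k_le: "k e \<le> m" if "\<And>n. n \<in> N \<Longrightarrow> q n - B e n \<le> m" for e m
    unfolding k_def by (rule cSUP_least[OF N_ne that])
  have k_q: "- q e \<le> k e" for e
  proof -
    obtain n where "n \<in> N" "0 \<le> q (e - n)" using N_max by blast
    then show ?thesis using k_ge[of n e] by (simp add: q_diff)
  qed
  have k_N: "k n \<le> - q n" if "n \<in> N" for n
    by (rule k_le) (use N[OF that] in \<open>fastforce simp: q_diff\<close>)
  have k_convex: "convex_on UNIV k"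
  proof (rule convex_onI)
    fix t :: real and x y :: 'e assume t: "0 < t" "t < 1"
    show "k ((1 - t) *\<^sub>R x + t *\<^sub>R y) \<le> (1 - t) * k x + t * k y"
    proof (rule k_le)
      fix n assume n: "n \<in> N"
      have "(1 - t) * (q n - B x n) + t * (q n - B y n) \<le> (1 - t) * k x + t * k y"
        using k_ge[OF n] t by (intro add_mono mult_left_mono) auto
      then show "q n - B ((1 - t) *\<^sub>R x + t *\<^sub>R y) n \<le> (1 - t) * k x + t * k y"
        by (simp add: B.add_left B.scaleR_left) (simp add: algebra_simps)
    qed
  qed simp
  have "continuous_on UNIV (\<lambda>e. q n - B e n)" for n
    by (intro continuous_intros linear_continuous_on B.bounded_linear_left)
  then obtain e0 d M where d: "d > 0" and M: "\<And>e n. norm (e - e0) < d \<Longrightarrow> n \<in> N \<Longrightarrow> q n - B e n \<le> M"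
    by (rule SUP_affine_locally_bounded[of N "\<lambda>n e. q n - B e n", OF _ bdd]) (erule that, blast)
  \<comment> \<open>\<open>K\<close> couples the variables of Phi and its conjugate:
    \<open>k\<close> at their midpoint plus the penalty of Psi.\<close>
  define K where "K v = k ((1/2) *\<^sub>R (fst v + snd v)) + (norm (fst v - snd v))\<^sup>2 / 8" for v :: "'e \<times> 'e"
  have K_convex: "convex_on UNIV K"
  proof -
    have "linear (\<lambda>v::'e \<times> 'e. (1/2) *\<^sub>R (fst v + snd v))" "linear (\<lambda>v::'e \<times> 'e. fst v - snd v)"
      by (auto intro!: linearI simp: algebra_simps)
    from convex_on_compose_linear[OF k_convex this(1)] convex_on_compose_linear[OF convex_on_norm_power2 this(2)]
    have "convex_on UNIV (\<lambda>v. k ((1/2) *\<^sub>R (fst v + snd v)) + (1/8) * (norm (fst v - snd v :: 'e))\<^sup>2)"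
      by (intro convex_on_add convex_on_cmul) auto
    then show ?thesis by (simp add: K_def[abs_def])
  qed
  \<comment> \<open>Near the diagonal point \<open>(e0, e0)\<close> the midpoint stays where
    \<open>k\<close> is bounded, and the two components differ by at most
    \<open>2 * d\<close>.\<close>
  have K_bdd: "K v \<le> M + (2 * d)\<^sup>2 / 8" if "norm (v - (e0, e0)) < d" for v
  proof -
    obtain y z where v: "v = (y, z)" by (cases v)
    have y: "norm (y - e0) < d" and z: "norm (z - e0) < d"
      using that norm_fst_le[of "y - e0" "z - e0"] norm_snd_le[of "z - e0" "y - e0"] by (auto simp: v)
    have "(1/2) *\<^sub>R (y + z) - e0 = (1/2) *\<^sub>R (y - e0) + (1/2) *\<^sub>R (z - e0)"
      by (simp add: algebra_simps flip: scaleR_add_left)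
    then have "norm ((1/2) *\<^sub>R (y + z) - e0) < d"
      using norm_triangle_ineq[of "(1/2) *\<^sub>R (y - e0)" "(1/2) *\<^sub>R (z - e0)"] y z by simp
    then have "k ((1/2) *\<^sub>R (y + z)) \<le> M" by (intro k_le M)
    moreover have "norm (y - z) \<le> 2 * d"
      using norm_triangle_ineq4[of "y - e0" "z - e0"] y z by simp
    then have "(norm (y - z))\<^sup>2 \<le> (2 * d)\<^sup>2" by (rule power_mono) simp
    ultimately show ?thesis by (simp add: K_def v)
  qed
  let ?P = "Phi_epi G" and ?Q = "conj_epi (Phi_epi G)"
  \<comment> \<open>The epigraph of the primal objective: half of Phi at \<open>y\<close> plus half
    of its conjugate at \<open>z\<close>.\<close>
  define D where "D = {((y, z), (r + s) / 2) | y z r s. (y, r) \<in> ?P \<and> (z, s) \<in> ?Q}"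
  have D_convex: "convex D"
  proof (rule convexI)
    fix a b :: "('e \<times> 'e) \<times> real" and t t' :: real
    assume "a \<in> D" "b \<in> D" and t: "0 \<le> t" "0 \<le> t'" "t + t' = 1"
    then obtain y z r s y' z' r' s' where
      a: "a = ((y, z), (r + s) / 2)" "(y, r) \<in> ?P" "(z, s) \<in> ?Q" and
      b: "b = ((y', z'), (r' + s') / 2)" "(y', r') \<in> ?P" "(z', s') \<in> ?Q"
      unfolding D_def by blast
    have "(t *\<^sub>R y + t' *\<^sub>R y', t * r + t' * r') \<in> ?P" "(t *\<^sub>R z + t' *\<^sub>R z', t * s + t' * s') \<in> ?Q"
      using convexD[OF convex_Phi_epi a(2) b(2) t] convexD[OF convex_conj_epi a(3) b(3) t] by simp_all
    moreover have "t *\<^sub>R a + t' *\<^sub>R b = ((t *\<^sub>R y + t' *\<^sub>R y', t *\<^sub>R z + t' *\<^sub>R z'),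
        ((t * r + t' * r') + (t * s + t' * s')) / 2)"
      by (simp add: a(1) b(1) field_simps)
    ultimately show "t *\<^sub>R a + t' *\<^sub>R b \<in> D" unfolding D_def by blast
  qed
  obtain g0 where g0: "g0 \<in> G" using G(1) by blast
  have self: "(g, q g) \<in> ?P" "(g, q g) \<in> ?Q" if "g \<in> G" for g
    using Phi_epi_self[of G g] conj_Phi_epi_self[of g G] G(2) that by auto
  have D_ne: "D \<noteq> {}" using self[OF g0] unfolding D_def by blast
  \<comment> \<open>Fenchel-Young gives \<open>(r + s) / 2 \<ge> B y z / 2\<close>; with the penalty
    this is at least \<open>q\<close> of the midpoint, which \<open>k \<ge> - q\<close>
    compensates.\<close>
  have weak: "0 \<le> \<rho> + K v" if vD: "(v, \<rho>) \<in> D" for v \<rho>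
  proof -
    obtain y z r s where v: "v = (y, z)" "\<rho> = (r + s) / 2" "(y, r) \<in> ?P" "(z, s) \<in> ?Q"
      using vD unfolding D_def by blast
    have "B y z - r \<le> s" using v by (auto simp: conj_epi_def)
    then show ?thesis
      using k_q[of "(1/2) *\<^sub>R (y + z)"] q_midpoint_le[of y z]
      unfolding K_def v fst_conv snd_conv by argo
  qed
  obtain L where L: "bounded_linear L" and dual: "\<And>v \<rho> w. (v, \<rho>) \<in> D \<Longrightarrow> 0 \<le> \<rho> + L v + K w - L w"
    by (rule Fenchel_duality[OF D_convex D_ne K_convex d K_bdd weak]) (assumption, assumption, erule that, blast)
  have "bounded_linear (\<lambda>y. L (y, 0))" "bounded_linear (\<lambda>z. L (0, z))"
    by (intro bounded_linear_compose[OF L] bounded_linear_Pair bounded_linear_ident bounded_linear_zero)+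
  then obtain b' a' where ab': "\<And>y. L (y, 0) = B y b'" "\<And>z. L (0, z) = B z a'"
    using represent by metis
  \<comment> \<open>The names cross: the slope in \<open>y\<close>, the variable of Phi, is a point
    for the conjugate, and the slope in \<open>z\<close> a point for Phi. The factor -2 absorbs the
    sign and the weight 1/2 in \<open>D\<close>.\<close>
  define a b where "a = (-2) *\<^sub>R a'" and "b = (-2) *\<^sub>R b'"
  have L_eq: "L (y, z) = - (B y b + B z a) / 2" for y z
  proof -
    have "L (y, z) = L (y, 0) + L (0, z)"
      using linear_add[OF bounded_linear.linear[OF L], of "(y, 0)" "(0, z)"] by simp
    then show ?thesis by (simp add: ab' a_def b_def B.scaleR_right B.minus_right)
  qed
  define W where "W v = K v + (B (fst v) b + B (snd v) a) / 2" for v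
  have main: "(B y b - r) / 2 + (B z a - s) / 2 \<le> W v" if "(y, r) \<in> ?P" "(z, s) \<in> ?Q" for y r z s v
  proof -
    have "((y, z), (r + s) / 2) \<in> D" using that unfolding D_def by blast
    from dual[OF this, of v] show ?thesis
      by (cases v) (simp add: L_eq W_def field_simps)
  qed
  \<comment> \<open>For \<open>z\<close> only the points \<open>(g, q g)\<close> of
    \<open>?Q\<close> are inserted into \<open>main\<close>, so \<open>\<alpha>\<close> is the
    Fitzpatrick value at \<open>a\<close> itself; \<open>\<beta>\<close> is the value of the
    conjugate at \<open>b\<close>.\<close>
  define \<alpha> where "\<alpha> = (SUP g\<in>G. B g a - q g)"
  define \<beta> where "\<beta> = (SUP (y, r)\<in>?P. B y b - r)"
  \<comment> \<open>\<open>main\<close> with the fixed point \<open>g0\<close> and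
    \<open>v = 0\<close> makes the supremum real.\<close>
  have "bdd_above ((\<lambda>g. B g a - q g) ` G)"
  proof (rule bdd_aboveI2)
    fix g assume "g \<in> G"
    from main[OF self(1)[OF g0] self(2)[OF this], of 0]
    show "B g a - q g \<le> 2 * W 0 - (B g0 b - q g0)" by (simp add: field_simps)
  qed
  then have \<alpha>: "B g a - q g \<le> \<alpha>" if "g \<in> G" for g
    unfolding \<alpha>_def using that by (rule cSUP_upper2) simp
  have main2: "B y b - r \<le> 2 * W v - \<alpha>" if yr: "(y, r) \<in> ?P" for y r v
  proof -
    have "\<alpha> \<le> 2 * W v - (B y b - r)"
      unfolding \<alpha>_def
    proof (rule cSUP_least[OF G(1)])
      fix g assume "g \<in> G"
      from main[OF yr self(2)[OF this], of v]
      show "B g a - q g \<le> 2 * W v - (B y b - r)" by (simp add: field_simps)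
    qed
    then show ?thesis by simp
  qed
  have P_ne: "?P \<noteq> {}" using self(1)[OF g0] by blast
  have "bdd_above ((\<lambda>(y, r). B y b - r) ` ?P)"
    by (rule bdd_aboveI2[where M = "2 * W 0 - \<alpha>"]) (use main2[where v = 0] in auto)
  then have \<beta>: "B y b - r \<le> \<beta>" if "(y, r) \<in> ?P" for y r
    unfolding \<beta>_def using cSUP_upper[of "(y, r)" ?P "\<lambda>(y, r). B y b - r"] that by simp
  have \<alpha>\<beta>: "(\<alpha> + \<beta>) / 2 \<le> W v" for v
  proof -
    have "\<beta> \<le> 2 * W v - \<alpha>" unfolding \<beta>_def by (rule cSUP_least[OF P_ne]) (use main2[where v = v] in auto)
    then show ?thesis by simp
  qed
  have a_epi: "(a, \<alpha>) \<in> ?P" using \<alpha> by (auto simp: Phi_epi_def sym[of a])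
  have b_epi: "(b, \<beta>) \<in> ?Q" using \<beta> by (auto simp: conj_epi_def)
  define u where "u = (1/2) *\<^sub>R (a + b)"
  \<comment> \<open>In coordinates \<open>v = (e + f, e - f)\<close>, minimising \<open>W\<close>
    over \<open>f\<close> produces the conjugate of half the squared norm at half of
    \<open>a - b\<close>, which \<open>norming\<close> evaluates up to
    \<open>\<epsilon>\<close>.\<close>
  have step: "(\<alpha> + \<beta>) / 2 + (norm (a - b))\<^sup>2 / 8 \<le> k e + B e u" for e
  proof (rule field_le_epsilon)
    fix \<epsilon> :: real assume "\<epsilon> > 0"
    then obtain f where f: "(norm ((1/2) *\<^sub>R (a - b)))\<^sup>2 / 2 - \<epsilon> \<le> B f ((1/2) *\<^sub>R (a - b)) - (norm f)\<^sup>2 / 2"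
      using norming by blast
    have "(1/2) *\<^sub>R (e + f + (e - f)) = e" "e + f - (e - f) = 2 *\<^sub>R f"
      by (simp_all add: scaleR_2 flip: scaleR_2)
    then have "W (e + f, e - f) = k e + (norm f)\<^sup>2 / 2 + B e u - B f ((1/2) *\<^sub>R (a - b))"
      by (simp add: W_def K_def u_def B.add_left B.diff_left B.add_right B.diff_right B.scaleR_right
          power_mult_distrib field_simps)
    moreover have "(norm ((1/2) *\<^sub>R (a - b)))\<^sup>2 / 2 = (norm (a - b))\<^sup>2 / 8"
      by (simp add: power_divide)
    ultimately show "(\<alpha> + \<beta>) / 2 + (norm (a - b))\<^sup>2 / 8 \<le> k e + B e u + \<epsilon>"
      using \<alpha>\<beta>[of "(e + f, e - f)"] f by argo
  qed
  \<comment> \<open>At \<open>e = n\<close>, \<open>k n \<le> - q n\<close> bounds the right side of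
    \<open>step\<close> by \<open>q u - q (u - n)\<close>; \<open>a\<close> and \<open>b\<close> are
    the witness pair for Psi.\<close>
  have in_Psi: "(u, q u - q (u - n)) \<in> Psi_epi G" if "n \<in> N" for n
  proof -
    have "(\<alpha> + \<beta>) / 2 + (norm (a - b))\<^sup>2 / 8 \<le> q u - q (u - n)"
      using step[of n] k_N[OF that] by (simp add: q_diff sym[of u n])
    moreover have "a + b = 2 *\<^sub>R u" by (simp add: u_def)
    ultimately show ?thesis using a_epi b_epi unfolding avg_epi_def by blast
  qed
  have le: "q (u - n) \<le> 0" if "n \<in> N" for n
    using Psi_epi_ge[OF in_Psi[OF that]] by simp
  \<comment> \<open>For this \<open>n\<close> both signs hold, so \<open>q (u - n) = 0\<close> and
    \<open>in_Psi\<close> gives height exactly \<open>q u\<close>.\<close>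
  obtain n where "n \<in> N" "0 \<le> q (u - n)" using N_max by blast
  then have "(u, q u) \<in> Psi_epi G" using in_Psi[of n] le[of n] by simp
  then show thesis using le that by blast
qed

end

subsection \<open>The product of a reflexive space and its dual\<close>

definition prod_pairing :: "('a \<Rightarrow> 'b \<Rightarrow> real) \<Rightarrow> 'a \<times> 'b \<Rightarrow> 'a \<times> 'b \<Rightarrow> real" where
  "prod_pairing p e f = p (fst e) (snd f) + p (fst f) (snd e)"

lemma norm_power2_prod: "(norm e)\<^sup>2 = (norm (fst e))\<^sup>2 + (norm (snd e))\<^sup>2"
  by (cases e) (simp add: norm_Pair)

text \<open>A subgradient at 0 of \<open>\<lambda>w. norm (d + w)\<close> is norming for
  \<open>d\<close>: the triangle inequality gives \<open>L x \<le> norm x\<close>, and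
  \<open>w = - d\<close> gives \<open>norm d \<le> L d\<close>.\<close>

lemma norming_functional:
  fixes d :: "'a::real_normed_vector"
  obtains L :: "'a \<Rightarrow> real" where "bounded_linear L" "\<And>x. L x \<le> norm x" "norm d \<le> L d"
proof -
  have "convex_on UNIV (\<lambda>w. norm (d + w))"
  proof (rule convex_onI)
    fix t :: real and x y :: 'a assume t: "0 < t" "t < 1"
    have "d + ((1 - t) *\<^sub>R x + t *\<^sub>R y) = (1 - t) *\<^sub>R (d + x) + t *\<^sub>R (d + y)"
      by (simp add: algebra_simps)
    then show "norm (d + ((1 - t) *\<^sub>R x + t *\<^sub>R y)) \<le> (1 - t) * norm (d + x) + t * norm (d + y)"
      using norm_triangle_ineq[of "(1 - t) *\<^sub>R (d + x)" "t *\<^sub>R (d + y)"] t by simp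
  qed simp
  then obtain L where L: "linear L" "\<And>w. norm (d + 0) + L w \<le> norm (d + w)"
    using convex_subgradient_at_0 by blast
  have le: "L x \<le> norm x" for x using L(2)[of x] norm_triangle_ineq[of d x] by simp
  have "norm d \<le> L d" using L(2)[of "- d"] linear_neg[OF L(1), of d] by simp
  moreover have "bounded_linear L"
  proof (rule linear_bounded_above_imp_bounded_linear[OF L(1), of 1 0 1])
    show "L x \<le> 1" if "norm (x - 0) < 1" for x using le[of x] that by simp
  qed simp
  ultimately show thesis using le that by blast
qed

locale reflexive_dual_pair =
  fixes p :: "'a::banach \<Rightarrow> 'b::banach \<Rightarrow> real"
  assumes reflexive: "reflexive_pairing p"
begin

sublocale p: bounded_bilinear p
  using reflexive by (simp add: reflexive_pairing_def dual_pairing_def)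

lemma norm_dual_eq: "norm x' = (SUP x\<in>{x. norm x \<le> 1}. p x x')"
  using reflexive by (simp add: reflexive_pairing_def dual_pairing_def)

lemma represent_fst: "bounded_linear f \<Longrightarrow> \<exists>x'. f = (\<lambda>x. p x x')"
  using reflexive by (simp add: reflexive_pairing_def dual_pairing_def)

lemma represent_snd: "bounded_linear g \<Longrightarrow> \<exists>x. g = p x"
  using reflexive by (simp add: reflexive_pairing_def)

text \<open>The supremum in the dual norm bounds its terms once its set is bounded above, which the
  constant \<open>K\<close> of the bilinear form ensures; scaling \<open>x\<close> to norm 1 does
  the rest.\<close>

lemma pairing_le: "p x x' \<le> norm x * norm x'"
proof (cases "x = 0")
  case True then show ?thesis by (simp add: p.zero_left)
next
  case False
  obtain K where K: "K \<ge> 0" "\<And>x x'. norm (p x x') \<le> norm x * norm x' * K"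
    using p.nonneg_bounded by blast
  have "bdd_above ((\<lambda>x. p x x') ` {x. norm x \<le> 1})"
  proof (rule bdd_aboveI2)
    fix x assume "x \<in> {x::'a. norm x \<le> 1}"
    then have "norm x * (norm x' * K) \<le> 1 * (norm x' * K)"
      using K(1) by (intro mult_right_mono) auto
    then show "p x x' \<le> norm x' * K" using K(2)[of x x'] by (simp add: mult.assoc)
  qed
  then have "p ((1 / norm x) *\<^sub>R x) x' \<le> norm x'"
    unfolding norm_dual_eq[of x'] by (rule cSUP_upper[rotated]) (use False in simp)
  then show ?thesis using False by (simp add: p.scaleR_left field_simps)
qed

lemma norming_fst:
  assumes "\<epsilon> > 0"
  shows "\<exists>f. (norm d')\<^sup>2 / 2 - \<epsilon> \<le> p f d' - (norm f)\<^sup>2 / 2"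
proof (cases "d' = 0")
  case True
  then show ?thesis using assms by (intro exI[of _ 0]) (simp add: p.zero_right)
next
  case False
  \<comment> \<open>A nearly norming point of the unit ball; the loss
    \<open>\<epsilon> / norm d'\<close> becomes \<open>\<epsilon>\<close> after scaling by
    \<open>norm d'\<close>.\<close>
  have "\<exists>x. norm x \<le> 1 \<and> norm d' - \<epsilon> / norm d' \<le> p x d'"
  proof (rule ccontr)
    assume "\<not> ?thesis"
    then have "p x d' \<le> norm d' - \<epsilon> / norm d'" if "norm x \<le> 1" for x
      using that by (meson linear)
    then have "norm d' \<le> norm d' - \<epsilon> / norm d'"
      by (subst norm_dual_eq) (rule cSUP_least, auto intro: exI[of _ 0])
    moreover have "\<epsilon> / norm d' > 0" using assms False by simp
    ultimately show False by linarith
  qed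
  then obtain x where x: "norm x \<le> 1" "norm d' - \<epsilon> / norm d' \<le> p x d'" by blast
  have "(norm d')\<^sup>2 - \<epsilon> \<le> norm d' * p x d'"
    using mult_left_mono[OF x(2), of "norm d'"] False
    by (simp add: right_diff_distrib power2_eq_square)
  moreover have "(norm d' * norm x)\<^sup>2 \<le> (norm d')\<^sup>2"
    using x(1) by (intro power_mono) (auto simp: mult_left_le)
  ultimately show ?thesis
    by (intro exI[of _ "norm d' *\<^sub>R x"])
      (unfold p.scaleR_left real_scaleR_def norm_scaleR abs_norm_cancel, argo)
qed

text \<open>The representative of a norming functional of \<open>d\<close> has dual norm at most 1;
  scaled by \<open>norm d\<close> it attains the bound.\<close>

lemma norming_snd: "\<exists>f'. (norm d)\<^sup>2 / 2 \<le> p d f' - (norm f')\<^sup>2 / 2"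
proof -
  obtain L where L: "bounded_linear L" "\<And>x. L x \<le> norm x" "norm d \<le> L d"
    using norming_functional[of d] by blast
  obtain x' where x': "L = (\<lambda>x. p x x')" using represent_fst[OF L(1)] by blast
  have "norm x' \<le> 1"
    by (subst norm_dual_eq, rule cSUP_least) (use L(2) x' order_trans in \<open>auto intro: exI[of _ 0]\<close>)
  then have "(norm d * norm x')\<^sup>2 \<le> (norm d)\<^sup>2"
    by (intro power_mono) (auto simp: mult_left_le)
  moreover have "(norm d)\<^sup>2 \<le> norm d * p d x'"
    using L(3) x' by (simp add: power2_eq_square mult_left_mono)
  ultimately show ?thesis
    by (intro exI[of _ "norm d *\<^sub>R x'"])
      (unfold p.scaleR_right real_scaleR_def norm_scaleR abs_norm_cancel, argo)
qed

sublocale symmetric_dual "prod_pairing p"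
proof
  obtain K where K: "K \<ge> 0" "\<And>x x'. norm (p x x') \<le> norm x * norm x' * K"
    using p.nonneg_bounded by blast
  show "\<exists>K. \<forall>a b. norm (prod_pairing p a b) \<le> norm a * norm b * K"
  proof (intro exI allI)
    fix a b :: "'a \<times> 'b"
    have "norm (p (fst e) (snd f)) \<le> norm e * norm f * K" for e f :: "'a \<times> 'b"
      using K(2)[of "fst e" "snd f"] norm_fst_le[of "fst e" "snd e"] norm_snd_le[of "snd f" "fst f"] K(1)
      by (intro order.trans[OF K(2)] mult_right_mono mult_mono) auto
    from this[of a b] this[of b a]
    show "norm (prod_pairing p a b) \<le> norm a * norm b * (2 * K)"
      by (simp add: prod_pairing_def mult.commute)
  qed
  fix e f :: "'a \<times> 'b"
  have "p (fst e) (snd f) + p (fst f) (snd e) \<le> norm (fst e) * norm (snd f) + norm (fst f) * norm (snd e)"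
    by (intro add_mono pairing_le)
  also have "\<dots> \<le> sqrt ((norm (fst e))\<^sup>2 + (norm (snd e))\<^sup>2) * sqrt ((norm (snd f))\<^sup>2 + (norm (fst f))\<^sup>2)"
  proof -
    \<comment> \<open>Lagrange's identity, which yields Cauchy-Schwarz for the crossed
      components.\<close>
    have "(norm (fst e) * norm (snd f) + norm (fst f) * norm (snd e))\<^sup>2
        + (norm (fst e) * norm (fst f) - norm (snd e) * norm (snd f))\<^sup>2
      = ((norm (fst e))\<^sup>2 + (norm (snd e))\<^sup>2) * ((norm (snd f))\<^sup>2 + (norm (fst f))\<^sup>2)"
      by (simp add: power2_eq_square algebra_simps)
    then show ?thesis
      unfolding real_sqrt_mult[symmetric]
      by (intro real_le_rsqrt) (metis le_add_same_cancel1 zero_le_power2)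
  qed
  also have "\<dots> = norm e * norm f" by (simp add: norm_prod_def add.commute)
  finally show "prod_pairing p e f \<le> norm e * norm f" by (simp add: prod_pairing_def)
next
  fix L :: "'a \<times> 'b \<Rightarrow> real" assume L: "bounded_linear L"
  have "bounded_linear (\<lambda>x. L (x, 0))" "bounded_linear (\<lambda>x'. L (0, x'))"
    by (intro bounded_linear_compose[OF L] bounded_linear_Pair bounded_linear_ident bounded_linear_zero)+
  then obtain a' a where "(\<lambda>x. L (x, 0)) = (\<lambda>x. p x a')" "(\<lambda>x'. L (0, x')) = p a"
    using represent_fst represent_snd by metis
  then have "L (x, x') = p x a' + p a x'" for x x'
    using linear_add[OF bounded_linear.linear[OF L], of "(x, 0)" "(0, x')"]
    by (simp add: fun_eq_iff)
  then show "\<exists>a. L = (\<lambda>e. prod_pairing p e a)"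
    by (intro exI[of _ "(a, a')"]) (simp add: fun_eq_iff prod_pairing_def)
next
  fix \<epsilon> :: real and d :: "'a \<times> 'b" assume "\<epsilon> > 0"
  then obtain f where f: "(norm (snd d))\<^sup>2 / 2 - \<epsilon> \<le> p f (snd d) - (norm f)\<^sup>2 / 2"
    using norming_fst by blast
  obtain f' where f': "(norm (fst d))\<^sup>2 / 2 \<le> p (fst d) f' - (norm f')\<^sup>2 / 2"
    using norming_snd by blast
  show "\<exists>f. (norm d)\<^sup>2 / 2 - \<epsilon> \<le> prod_pairing p f d - (norm f)\<^sup>2 / 2"
    by (intro exI[of _ "(f, f')"])
      (use f f' in \<open>simp add: prod_pairing_def norm_power2_prod[of d] norm_power2_prod[of "(f, f')"] add_divide_distrib\<close>)
qed (simp_all add: prod_pairing_def p.add_left p.add_right p.scaleR_left p.scaleR_right algebra_simps)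

section \<open>Extended-real functions and their real epigraphs\<close>

lemma q_eq: "q e = p (fst e) (snd e)"
  by (simp add: q_def prod_pairing_def)

lemma fitzpatrick_le_iff: "fitzpatrick p G e \<le> ereal r \<longleftrightarrow> (e, r) \<in> Phi_epi G"
  by (cases e) (auto simp: fitzpatrick_def Phi_epi_def SUP_le_iff q_eq prod_pairing_def)

lemma fitzpatrick_gt_MInf: "G \<noteq> {} \<Longrightarrow> fitzpatrick p G e > - \<infinity>"
proof -
  assume "G \<noteq> {}"
  then obtain y y' where "(y, y') \<in> G" by auto
  then have "ereal (p (fst e) y' + p y (snd e) - p y y') \<le> fitzpatrick p G e"
    unfolding fitzpatrick_def split_def by (intro SUP_upper2[of "(y, y')"]) auto
  then show ?thesis by (cases "fitzpatrick p G e") auto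
qed

text \<open>Points with \<open>f e = \<infinity>\<close> constrain neither side: their term in the
  supremum is minus infinity, and no real \<open>r\<close> lies above them.\<close>

lemma fenchel_conj_le_iff:
  assumes "\<And>e. f e > - \<infinity>"
  shows "fenchel_conj p f (z', z) \<le> ereal s \<longleftrightarrow> ((z, z'), s) \<in> conj_epi {(e, r). f e \<le> ereal r}"
proof -
  have "ereal c - f e \<le> ereal s \<longleftrightarrow> (\<forall>r. f e \<le> ereal r \<longrightarrow> c - r \<le> s)" for c e
    using assms[of e] by (cases "f e") (auto intro: order_trans[rotated])
  then show ?thesis
    by (auto simp: fenchel_conj_def conj_epi_def SUP_le_iff prod_pairing_def)
qed

lemma fenchel_conj_gt_MInf:
  assumes "f e = ereal r"
  shows "fenchel_conj p f z > - \<infinity>"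
proof -
  obtain z1 z2 where z: "z = (z1, z2)" by (cases z)
  have "ereal (p (fst e) z1 + p z2 (snd e)) - f e \<le> fenchel_conj p f z"
    unfolding fenchel_conj_def z split_def by (intro SUP_upper2[of e]) auto
  then show ?thesis using assms by (cases "fenchel_conj p f z") auto
qed

text \<open>Nonemptiness of \<open>G\<close> keeps Phi above minus infinity and a point of
  \<open>Phi_epi G\<close> does so for the conjugate, so the sum in Psi never mixes opposite
  infinities.\<close>

context
  fixes G :: "('a \<times> 'b) set"
  assumes G: "G \<noteq> {}" "Phi_epi G \<noteq> {}"
begin

lemma fenchel_conj_fitzpatrick_le_iff:
  "fenchel_conj p (fitzpatrick p G) (z', z) \<le> ereal s \<longleftrightarrow> ((z, z'), s) \<in> conj_epi (Phi_epi G)"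
  by (subst fenchel_conj_le_iff[OF fitzpatrick_gt_MInf[OF G(1)]]) (simp add: fitzpatrick_le_iff)

lemma fenchel_conj_fitzpatrick_gt_MInf: "fenchel_conj p (fitzpatrick p G) z > - \<infinity>"
proof -
  obtain e r where "(e, r) \<in> Phi_epi G" using G(2) by auto
  then have "fitzpatrick p G e \<le> ereal r" by (simp add: fitzpatrick_le_iff)
  with fitzpatrick_gt_MInf[OF G(1), of e] obtain t where "fitzpatrick p G e = ereal t"
    by (cases "fitzpatrick p G e") auto
  then show ?thesis by (rule fenchel_conj_gt_MInf)
qed

lemma Psi_le:
  assumes "(u, r) \<in> Psi_epi G"
  shows "Psi p (fitzpatrick p G) u \<le> ereal r"
proof -
  obtain y y' z z' s t where *: "(y, y') + (z, z') = 2 *\<^sub>R u" "((y, y'), s) \<in> Phi_epi G"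
    "((z, z'), t) \<in> conj_epi (Phi_epi G)" "(s + t) / 2 + (norm ((y, y') - (z, z')))\<^sup>2 / 8 \<le> r"
    using assms by (auto simp: avg_epi_def)
  have "ereal (1/2) * fitzpatrick p G (y, y') + ereal (1/2) * fenchel_conj p (fitzpatrick p G) (z', z)
      + ereal ((norm (y - z))\<^sup>2 / 8 + (norm (y' - z'))\<^sup>2 / 8)
    \<le> ereal (1/2) * ereal s + ereal (1/2) * ereal t + ereal ((norm (y - z))\<^sup>2 / 8 + (norm (y' - z'))\<^sup>2 / 8)"
    using *(2,3) by (intro add_mono ereal_mult_left_mono order_refl)
      (auto simp: fitzpatrick_le_iff fenchel_conj_fitzpatrick_le_iff)
  also have "\<dots> \<le> ereal r"
    using *(4) by (simp add: norm_power2_prod add_divide_distrib)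
  finally show ?thesis
    using *(1) unfolding Psi_def by (cases u) (auto intro: INF_lower2[of "(y, y', z, z')"])
qed

text \<open>A strict bound on the infimum yields a witness, at which both summands are finite since
  neither is minus infinity.\<close>

lemma Psi_less:
  assumes "Psi p (fitzpatrick p G) u < ereal r"
  shows "(u, r) \<in> Psi_epi G"
proof -
  let ?f = "fitzpatrick p G" let ?g = "fenchel_conj p (fitzpatrick p G)"
  obtain y y' z z' where *: "(y, y') + (z, z') = 2 *\<^sub>R u"
    "ereal (1/2) * ?f (y, y') + ereal (1/2) * ?g (z', z)
      + ereal ((norm (y - z))\<^sup>2 / 8 + (norm (y' - z'))\<^sup>2 / 8) < ereal r"
    using assms unfolding Psi_def by (cases u) (auto simp: INF_less_iff)
  obtain s t where st: "?f (y, y') = ereal s" "?g (z', z) = ereal t"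
    using *(2) fitzpatrick_gt_MInf[OF G(1), of "(y, y')"] fenchel_conj_fitzpatrick_gt_MInf[of "(z', z)"]
    by (cases "?f (y, y')"; cases "?g (z', z)") auto
  have "((y, y'), s) \<in> Phi_epi G" "((z, z'), t) \<in> conj_epi (Phi_epi G)"
    using st by (simp_all flip: fitzpatrick_le_iff fenchel_conj_fitzpatrick_le_iff)
  moreover have "(s + t) / 2 + (norm ((y, y') - (z, z')))\<^sup>2 / 8 \<le> r"
    using *(2) by (simp add: st norm_power2_prod add_divide_distrib)
  ultimately show ?thesis using *(1) unfolding avg_epi_def by blast
qed

lemma Psi_ge: "ereal (q u) \<le> Psi p (fitzpatrick p G) u"
proof (rule ccontr)
  assume "\<not> ?thesis"
  then obtain r where "Psi p (fitzpatrick p G) u < ereal r" "r < q u"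
    by (metis ereal_dense2 less_ereal.simps(1) not_le)
  then show False using Psi_epi_ge[OF Psi_less] by fastforce
qed

end

end

section \<open>The map \<open>T~\<close>: firm nonexpansiveness, uniqueness, extension and existence
  of values\<close>

theorem theorem8p1:
  fixes p :: "'a::banach \<Rightarrow> 'b::banach \<Rightarrow> real"
    and F :: "'a \<Rightarrow> 'b"
    and C :: "'a set"
    and T :: "'a \<Rightarrow> 'a"
  assumes "reflexive_pairing p"
    and "maximal_monotone_op p F"
    and "strictly_monotone_op p F"
    and "three_star_monotone_op p F"
    and "surj F"
    and "C \<noteq> {}"
    and "F_firmly_nonexpansive p F C T"
  shows "\<exists>Tt :: 'a \<Rightarrow> 'a.
           (\<forall>x. T_tilde p F C T x = {Tt x}) \<and>
           F_firmly_nonexpansive p F UNIV Tt \<and>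
           (\<forall>x\<in>C. Tt x = T x)"
proof -
  interpret reflexive_dual_pair p by unfold_locales fact
  let ?G = "graph_A F C T"
  have G_pos: "0 \<le> q (g - h)" if gh: "g \<in> ?G" "h \<in> ?G" for g h
  proof -
    obtain x y where xy: "x \<in> C" "y \<in> C" "g = (T x, F x - F (T x))" "h = (T y, F y - F (T y))"
      using gh by (auto simp: graph_A_def)
    have "p (T x - T y) (F (T x) - F (T y)) \<le> p (T x - T y) (F x - F y)"
      using assms(7) xy by (simp add: F_firmly_nonexpansive_def)
    then show ?thesis by (simp add: xy q_eq p.diff_right)
  qed
  have G_ne: "?G \<noteq> {}" using assms(6) by (auto simp: graph_A_def)
  then have Phi_ne: "Phi_epi ?G \<noteq> {}" using Phi_epi_self[of ?G] G_pos by blast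
  note Psi_rules = Psi_le[OF G_ne Phi_ne] Psi_less[OF G_ne Phi_ne] Psi_ge[OF G_ne Phi_ne]
  have contactI: "u \<in> graph_A_tilde p F C T" if "(u, q u) \<in> Psi_epi ?G" for u
    using Psi_rules(1)[OF that] Psi_rules(3)[of u]
    by (cases u) (auto simp: graph_A_tilde_def q_eq intro: antisym)
  \<comment> \<open>Contact is an equality with an infimum, so witnesses are extracted with slack
    \<open>\<epsilon>\<close>.\<close>
  have contactD: "(u, q u + \<epsilon>) \<in> Psi_epi ?G" if "u \<in> graph_A_tilde p F C T" "\<epsilon> > 0" for u \<epsilon>
    by (rule Psi_rules(2)) (use that in \<open>auto simp: graph_A_tilde_def q_eq\<close>)
  have tilde_mono: "0 \<le> p (u - v) (a - b)"
    if "(u, a) \<in> graph_A_tilde p F C T" "(v, b) \<in> graph_A_tilde p F C T" for u v a b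
    using Psi_contact_positive[OF contactD[OF that(1)] contactD[OF that(2)]] by (simp add: q_eq)
  \<comment> \<open>Monotonicity of the graph of \<open>A~\<close> for \<open>a = F x - F u\<close>
    and \<open>b = F y - F v\<close>.\<close>
  have firm: "p (u - v) (F u - F v) \<le> p (u - v) (F x - F y)"
    if uv: "u \<in> T_tilde p F C T x" "v \<in> T_tilde p F C T y" for u v x y
  proof -
    obtain a b where "(u, a) \<in> graph_A_tilde p F C T" "F x = a + F u"
      "(v, b) \<in> graph_A_tilde p F C T" "F y = b + F v"
      using uv by (auto simp: T_tilde_def)
    then show ?thesis using tilde_mono[of u a v b] by (simp add: algebra_simps p.diff_right p.add_right)
  qed
  \<comment> \<open>For equal \<open>x\<close> the right side of \<open>firm\<close> is 0, which
    strict monotonicity excludes unless \<open>u = v\<close>.\<close>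
  have unique: "u = v" if "u \<in> T_tilde p F C T x" "v \<in> T_tilde p F C T x" for u v x
    using firm[OF that] assms(3) by (force simp: strictly_monotone_op_def p.zero_right)
  have ext: "T x \<in> T_tilde p F C T x" if "x \<in> C" for x
  proof -
    have "(T x, F x - F (T x)) \<in> ?G" using that by (auto simp: graph_A_def)
    then have "(T x, F x - F (T x)) \<in> graph_A_tilde p F C T"
      using Psi_epi_self[of ?G] G_pos by (intro contactI) blast
    then show ?thesis by (auto simp: T_tilde_def)
  qed
  have ex: "\<exists>u. u \<in> T_tilde p F C T x" for x
  proof -
    let ?N = "range (\<lambda>t. (t, F x - F t))"
    have mono: "0 \<le> p (t - s) (F t - F s)" for s t
      using assms(2) unfolding maximal_monotone_op_def monotone_op_def by blast
    have max: "x' = F e" if "\<And>t. 0 \<le> p (e - t) (x' - F t)" for e x'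
      using assms(2) that unfolding maximal_monotone_op_def by blast
    \<comment> \<open>Reflecting \<open>e'\<close> to \<open>F x - e'\<close> turns
      \<open>- q\<close> of a difference into the monotonicity expression of \<open>F\<close>, so
      the hypotheses on \<open>N\<close> translate into those on \<open>F\<close>.\<close>
    have q_N: "q (e - t, e' - (F x - F t)) = - p (e - t) ((F x - e') - F t)" for e e' t
      by (simp add: q_eq p.diff_right)
    have N: "q (m - n) \<le> 0" if mn: "m \<in> ?N" "n \<in> ?N" for m n
    proof -
      obtain s t where "m = (s, F x - F s)" "n = (t, F x - F t)" using mn by blast
      then show ?thesis using mono[of s t] q_N[of s t "F x - F s"] by simp
    qed
    have N_max: "\<exists>n\<in>?N. 0 \<le> q (e - n)" for e
    proof (rule ccontr)
      obtain e1 e2 where e: "e = (e1, e2)" by (cases e)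
      assume "\<not> ?thesis"
      \<comment> \<open>If all these values are positive, maximality forces
        \<open>F x - e2 = F e1\<close>, and then the value at \<open>t = e1\<close> is 0.\<close>
      then have less: "0 < p (e1 - t) ((F x - e2) - F t)" for t
        by (auto simp: e q_N not_le)
      then have "F x - e2 = F e1" by (intro max less_imp_le)
      with less[of e1] show False by (simp add: p.zero_right)
    qed
    have N_bdd: "bdd_above ((\<lambda>n. q (e - n)) ` ?N)" for e
    proof -
      obtain e1 e2 where e: "e = (e1, e2)" by (cases e)
      have "bdd_above (range (\<lambda>t. p (e1 - t) (F t - (F x - e2))))"
        using assms(4) by (simp add: three_star_monotone_op_def)
      then show ?thesis unfolding e image_image diff_Pair q_N by (simp add: p.diff_right)
    qed
    obtain u where u: "(u, q u) \<in> Psi_epi ?G" "\<And>n. n \<in> ?N \<Longrightarrow> q (u - n) \<le> 0"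
      using Psi_contact_exists[OF G_ne G_pos N N_max N_bdd] by blast
    obtain u1 u2 where u12: "u = (u1, u2)" by (cases u)
    have "0 \<le> p (u1 - t) ((F x - u2) - F t)" for t
      using u(2)[of "(t, F x - F t)"] by (simp add: u12 q_N)
    then have "F x - u2 = F u1" by (rule max)
    then have "F x = u2 + F u1" by (simp add: algebra_simps)
    moreover have "(u1, u2) \<in> graph_A_tilde p F C T" using contactI[OF u(1)] by (simp add: u12)
    ultimately show ?thesis by (auto simp: T_tilde_def)
  qed
  define Tt where "Tt x = (SOME u. u \<in> T_tilde p F C T x)" for x
  have Tt: "Tt x \<in> T_tilde p F C T x" for x unfolding Tt_def by (rule someI_ex[OF ex])
  show ?thesis
  proof (intro exI[of _ Tt] conjI allI ballI)
    show "T_tilde p F C T x = {Tt x}" for x using Tt unique by blast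
    show "F_firmly_nonexpansive p F UNIV Tt" using firm[OF Tt Tt] by (simp add: F_firmly_nonexpansive_def)
    show "Tt x = T x" if "x \<in> C" for x using unique[OF Tt ext[OF that]] .
  qed
qed

end
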